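(* Let $N=N(Q_n,m,r)$ be a quasi $Q_n$-filiform Lie algebra with the elements $e_{ij}$ and basis fixed in the context, and write $e_{in}=\sum_{j=1}^{r}b_{ij}e_{jn}$ for $1\le i\le m$. Let $\delta$ be a linear transformation of $N$ such that for every $1\le s\le m$ $$\delta e_{st}=\sum_{i=1}^{m}\sum_{j=0}^{n-1}c^{st}_{ij}e_{ij}+\sum_{i=1}^{r}c^{st}_{in}e_{in},\qquad t=0,1,$$ $$\delta e_{st}=[\delta e_{s0},e_{s,t-1}]+[e_{s0},\delta e_{s,t-1}],\qquad 2\le t\le n-1,$$ and $$\delta e_{sn}=-[\delta e_{s1},e_{s,n-1}]-[e_{s1},\delta e_{s,n-1}],\qquad 1\le s\le r,$$ where the $c^{st}_{ij}$ are complex numbers. Put $\lambda_s=(n-2)c^{s0}_{s0}+2c^{s1}_{s1}$ for $1\le s\le m$. Then $\delta$ is a derivation of $N$ if and only if for all $1\le s,p\le m$ the following hold: (i) $b_{sj}(\lambda_s-\lambda_j)=0$ whenever $s>r$ and $1\le j\le r$; (ii) $\delta e_{s0}=c^{s0}_{s0}e_{s0}+\sum_{i=2}^{n-1}c^{s0}_{si}e_{si}+\sum_{i=1}^{r}c^{s0}_{in}e_{in}$; (iii) $\delta e_{s1}=\sum_{i=1}^{n-2}c^{s1}_{si}e_{si}+\sum_{i=1}^{m}c^{s1}_{i,n-1}e_{i,n-1}+\sum_{i=1}^{r}c^{s1}_{in}e_{in}$; (iv) $c^{s1}_{si}=0$ for $i=3,5,\ldots,n-2$; (v) $\begin{pmatrix}-c^{s1}_{p,n-1}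 & c^{p1}_{s,n-1}\end{pmatrix}\begin{pmatrix} b_{p1}&b_{p2}&\cdots&b_{pr}\\ b_{s1}&b_{s2}&\cdots&b_{sr}\end{pmatrix}=0.$
   Context: All Lie algebras are finite dimensional over $\mathbb{C}$. The descending central series is $c^0N=N$, $c^iN=[N,c^{i-1}N]$. For $n=2d+1>3$, $Q_n$ is the $(n+1)$-dimensional Lie algebra with basis $e_0,e_1,\ldots,e_n$ and brackets $[e_0,e_i]=e_{i+1}$ ($1\le i\le n-2$), $[e_i,e_{n-i}]=(-1)^ie_n$ ($1\le i\le n-1$), all other brackets being zero or obtained by antisymmetry. A Lie algebra $N$ is a quasi $Q_n$-filiform Lie algebra, denoted $N(Q_n,m,r)$, if $N=N_1+N_2+\cdots+N_m$ (sum of subspaces, not necessarily direct) where each $N_i$ is a subalgebra isomorphic to $Q_n$, $[N_i,N_j]=0$ for $i\ne j$, and $r=\dim c^{n-1}N$. For each $i$, $e_{i0},e_{i1},\ldots,e_{in}$ is a basis of $N_i$ satisfying $[e_{i0},e_{ij}]=e_{i,j+1}$ ($1\le j\le n-2$), $[e_{ij},e_{i,n-j}]=(-1)^je_{in}$ ($1\le j\le n-1$), all other brackets among $e_{i0},\ldots,e_{in}$ being zero or obtained by antisymmetry. The elements $e_{ij}$ ($1\le i\le m$, $0\le j\le n-1$) are linearly independent, $c^{n-1}N$ is spanned by $e_{1n},\ldots,e_{mn}$, and the $N_i$ are numbered so that the elements $e_{ij}$ ($1\le i\le m$, $0\le j\le n-1$) together with $e_{1n},\ldots,e_{rn}$ form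 a basis of $N$. *)

theory Defs
  imports Complex_Main "HOL-Library.Function_Algebras"
begin

text \<open>
  The underlying vector space of a Lie algebra is a whole type; subalgebras are subsets of it.
  Finite dimension is a separate assumption because the coordinate model of \<open>Q\<^sub>n\<close> below lives in
  the infinite-dimensional space \<open>nat \<Rightarrow> complex\<close>.
\<close>

locale lie_algebra = vector_space scale
  for scale :: "complex \<Rightarrow> 'a::ab_group_add \<Rightarrow> 'a" +
  fixes bracket :: "'a \<Rightarrow> 'a \<Rightarrow> 'a"
  assumes linear_bracket_left: "Vector_Spaces.linear scale scale (\<lambda>x. bracket x y)"
    and linear_bracket_right: "Vector_Spaces.linear scale scale (\<lambda>y. bracket x y)"
    and bracket_self: "bracket x x = 0"
    and jacobi: "bracket x (bracket y z) + bracket y (bracket z x) + bracket z (bracket x y) = 0"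
begin

definition subalgebra :: "'a set \<Rightarrow> bool" where
  "subalgebra S \<longleftrightarrow> subspace S \<and> (\<forall>x\<in>S. \<forall>y\<in>S. bracket x y \<in> S)"

primrec central_series :: "nat \<Rightarrow> 'a set" where
  "central_series 0 = UNIV"
| "central_series (Suc i) = span {bracket x y | x y. x \<in> UNIV \<and> y \<in> central_series i}"

definition derivation :: "('a \<Rightarrow> 'a) \<Rightarrow> bool" where
  "derivation \<delta> \<longleftrightarrow> Vector_Spaces.linear scale scale \<delta> \<and>
     (\<forall>x y. \<delta> (bracket x y) = bracket (\<delta> x) y + bracket x (\<delta> y))"

definition basis_family :: "'i set \<Rightarrow> ('i \<Rightarrow> 'a) \<Rightarrow> 'a set \<Rightarrow> bool" where
  "basis_family I v S \<longleftrightarrow> inj_on v I \<and> independent (v ` I) \<and> span (v ` I) = S"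

definition Qn_brackets :: "nat \<Rightarrow> (nat \<Rightarrow> 'a) \<Rightarrow> bool" where
  "Qn_brackets n v \<longleftrightarrow>
     (\<forall>j\<in>{1..n-2}. bracket (v 0) (v j) = v (j + 1)) \<and>
     (\<forall>j\<in>{1..n-1}. bracket (v j) (v (n - j)) = scale ((-1) ^ j) (v n)) \<and>
     (\<forall>j\<in>{0..n}. \<forall>k\<in>{0..n}.
        \<not> (j = 0 \<and> k \<in> {1..n-2}) \<longrightarrow> \<not> (k = 0 \<and> j \<in> {1..n-2}) \<longrightarrow>
        \<not> (j \<in> {1..n-1} \<and> k = n - j) \<longrightarrow> bracket (v j) (v k) = 0)"

end

locale fin_dim_lie_algebra = lie_algebra +
  assumes finite_dimensional: "\<exists>B. finite B \<and> span B = UNIV"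

definition lie_isomorphic_on ::
  "(complex \<Rightarrow> 'a::ab_group_add \<Rightarrow> 'a) \<Rightarrow> ('a \<Rightarrow> 'a \<Rightarrow> 'a) \<Rightarrow> 'a set \<Rightarrow>
   (complex \<Rightarrow> 'b::ab_group_add \<Rightarrow> 'b) \<Rightarrow> ('b \<Rightarrow> 'b \<Rightarrow> 'b) \<Rightarrow> 'b set \<Rightarrow> bool" where
  "lie_isomorphic_on s1 b1 S1 s2 b2 S2 \<longleftrightarrow>
     (\<exists>f. bij_betw f S1 S2 \<and>
        (\<forall>x\<in>S1. \<forall>y\<in>S1. f (x + y) = f x + f y) \<and>
        (\<forall>a. \<forall>x\<in>S1. f (s1 a x) = s2 a (f x)) \<and>
        (\<forall>x\<in>S1. \<forall>y\<in>S1. f (b1 x y) = b2 (f x) (f y)))"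

text \<open>
  \<open>Q\<^sub>n\<close> in coordinates: \<open>f\<close> stands for \<open>f 0 e\<^sub>0 + \<dots> + f n e\<^sub>n\<close>.  The bracket is written down
  for all functions \<open>nat \<Rightarrow> complex\<close> (coordinates above \<open>n\<close> are ignored), and \<open>Q\<^sub>n\<close>
  is the subalgebra \<open>Qn_carrier n\<close>.
\<close>

definition fun_scale :: "complex \<Rightarrow> (nat \<Rightarrow> complex) \<Rightarrow> (nat \<Rightarrow> complex)" where
  "fun_scale a f = (\<lambda>k. a * f k)"

definition Qn_carrier :: "nat \<Rightarrow> (nat \<Rightarrow> complex) set" where
  "Qn_carrier n = {f. \<forall>k>n. f k = 0}"

definition Qn_bracket ::
  "nat \<Rightarrow> (nat \<Rightarrow> complex) \<Rightarrow> (nat \<Rightarrow> complex) \<Rightarrow> (nat \<Rightarrow> complex)" where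
  "Qn_bracket n f g = (\<lambda>k.
     if 2 \<le> k \<and> k \<le> n - 1 then f 0 * g (k - 1) - f (k - 1) * g 0
     else if k = n then (\<Sum>i=1..n-1. (-1) ^ i * f i * g (n - i))
     else 0)"

definition unit_fun :: "nat \<Rightarrow> nat \<Rightarrow> complex" where
  "unit_fun i = (\<lambda>k. if k = i then 1 else 0)"

text \<open>The coordinate model is a Lie algebra, and the unit vectors satisfy the bracket table of \<open>Q\<^sub>n\<close>.\<close>

lemma Qn_bracket_antisym:
  assumes "odd n"
  shows "Qn_bracket n g f = - Qn_bracket n f g"
proof
  fix k
  have "(\<Sum>i=1..n-1. (-1) ^ i * g i * f (n - i)) = (\<Sum>i=1..n-1. - ((-1) ^ i * f i * g (n - i)))"
  proof (rule sum.reindex_bij_witness[where i="\<lambda>i. n - i" and j="\<lambda>i. n - i"])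
    fix i assume i: "i \<in> {1..n-1}"
    then have "n - (n - i) = i" "even (n - i) \<longleftrightarrow> odd i"
      using assms by auto
    then have "(-1::complex) ^ (n - i) = - ((-1) ^ i)" by (cases "even i") auto
    then show "- ((- 1) ^ (n - i) * f (n - i) * g (n - (n - i))) = (- 1) ^ i * g i * f (n - i)"
      using \<open>n - (n - i) = i\<close> by simp
  qed (use assms in auto)
  then show "Qn_bracket n g f k = (- Qn_bracket n f g) k"
    by (simp add: Qn_bracket_def sum_negf)
qed

lemma Qn_bracket_nested:
  assumes "odd n" "n > 3"
  shows "Qn_bracket n f (Qn_bracket n g h) = (\<lambda>k.
    if 3 \<le> k \<and> k \<le> n - 1 then f 0 * (g 0 * h (k - 2) - g (k - 2) * h 0)
    else if k = n then g 0 * (\<Sum>i=1..n-2. (-1) ^ i * f i * h (n - 1 - i))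
                     - h 0 * (\<Sum>i=1..n-2. (-1) ^ i * f i * g (n - 1 - i))
    else 0)"
proof
  fix k
  have eq: "{1..n-1} = insert (n-1) {1..n-2}" using assms by auto
  have "(\<Sum>i=1..n-1. (-1) ^ i * f i * Qn_bracket n g h (n - i))
      = (\<Sum>i=1..n-2. (-1) ^ i * f i * Qn_bracket n g h (n - i))"
    using assms by (subst eq, subst sum.insert) (auto simp: Qn_bracket_def)
  also have "\<dots> = (\<Sum>i=1..n-2. g 0 * ((-1) ^ i * f i * h (n - 1 - i))
                              - h 0 * ((-1) ^ i * f i * g (n - 1 - i)))"
  proof (rule sum.cong[OF refl])
    fix i assume "i \<in> {1..n-2}"
    then have i: "2 \<le> n - i" "n - i \<le> n - 1" "n - i - 1 = n - 1 - i" using assms by auto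
    then show "(-1) ^ i * f i * Qn_bracket n g h (n - i) =
      g 0 * ((-1) ^ i * f i * h (n - 1 - i)) - h 0 * ((-1) ^ i * f i * g (n - 1 - i))"
      unfolding Qn_bracket_def by (simp add: algebra_simps)
  qed
  finally have A: "(\<Sum>i=1..n-1. (-1) ^ i * f i * Qn_bracket n g h (n - i)) =
      g 0 * (\<Sum>i=1..n-2. (-1) ^ i * f i * h (n - 1 - i))
    - h 0 * (\<Sum>i=1..n-2. (-1) ^ i * f i * g (n - 1 - i))"
    by (simp add: sum_subtractf sum_distrib_left)
  have B: "Qn_bracket n g h 0 = 0" "Qn_bracket n g h 1 = 0"
    using assms by (auto simp: Qn_bracket_def)
  consider "k = 2" | "3 \<le> k" "k \<le> n - 1" | "k = n" | "k < 2" | "k > n" using assms by linarith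
  then show "Qn_bracket n f (Qn_bracket n g h) k = (if 3 \<le> k \<and> k \<le> n - 1
    then f 0 * (g 0 * h (k - 2) - g (k - 2) * h 0)
    else if k = n then g 0 * (\<Sum>i=1..n-2. (-1) ^ i * f i * h (n - 1 - i))
                     - h 0 * (\<Sum>i=1..n-2. (-1) ^ i * f i * g (n - 1 - i))
    else 0)"
  proof cases
    case 1
    with B assms show ?thesis by (auto simp: Qn_bracket_def[of n f])
  next
    case 2
    then have "Qn_bracket n g h (k - 1) = g 0 * h (k - 2) - g (k - 2) * h 0"
      by (auto simp: Qn_bracket_def numeral_2_eq_2)
    with 2 B show ?thesis by (auto simp: Qn_bracket_def[of n f])
  next
    case 3
    with assms have "Qn_bracket n f (Qn_bracket n g h) k
      = (\<Sum>i=1..n-1. (-1) ^ i * f i * Qn_bracket n g h (n - i))"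
      by (simp add: Qn_bracket_def[of n f])
    with A 3 assms show ?thesis by simp
  qed (use assms in \<open>auto simp: Qn_bracket_def[of n f]\<close>)
qed

lemma Qn_middle_sym:
  assumes "odd n"
  shows "(\<Sum>i=1..n-2. (-1) ^ i * f i * h (n - 1 - i))
       = (\<Sum>i=1..n-2. (-1) ^ i * h i * (f (n - 1 - i) :: complex))"
proof (rule sum.reindex_bij_witness[where i="\<lambda>i. n - 1 - i" and j="\<lambda>i. n - 1 - i"])
  fix i assume i: "i \<in> {1..n-2}"
  then have "n - 1 - (n - 1 - i) = i" "even (n - 1 - i) \<longleftrightarrow> even i"
    using assms by auto
  then have "(-1::complex) ^ (n - 1 - i) = (-1) ^ i" by (cases "even i") auto
  with \<open>n - 1 - (n - 1 - i) = i\<close>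
  show "(- 1) ^ (n - 1 - i) * h (n - 1 - i) * f (n - 1 - (n - 1 - i)) = (- 1) ^ i * f i * h (n - 1 - i)"
    by simp
qed auto

lemma Qn_lie_algebra:
  assumes "odd n" "n > 3"
  shows "lie_algebra fun_scale (Qn_bracket n)"
proof -
  interpret vector_space fun_scale
    by unfold_locales (auto simp: fun_scale_def fun_eq_iff algebra_simps)
  have right: "Vector_Spaces.linear fun_scale fun_scale (Qn_bracket n x)" for x
    unfolding Vector_Spaces.linear_iff
    by (intro conjI allI vector_space_axioms)
       (auto simp: fun_eq_iff Qn_bracket_def fun_scale_def algebra_simps sum.distrib sum_distrib_left
         intro!: sum.cong)
  have left: "Vector_Spaces.linear fun_scale fun_scale (\<lambda>x. Qn_bracket n x y)" for y
    unfolding Vector_Spaces.linear_iff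
    by (intro conjI allI vector_space_axioms)
       (auto simp: fun_eq_iff Qn_bracket_def fun_scale_def algebra_simps sum.distrib sum_distrib_left
         intro!: sum.cong)
  show ?thesis
  proof
    fix x y z :: "nat \<Rightarrow> complex"
    show "Qn_bracket n x x = 0"
      using Qn_bracket_antisym[OF assms(1), of x x] by (auto simp: fun_eq_iff)
    show "Qn_bracket n x (Qn_bracket n y z) + Qn_bracket n y (Qn_bracket n z x)
      + Qn_bracket n z (Qn_bracket n x y) = 0"
      unfolding Qn_bracket_nested[OF assms]
      using Qn_middle_sym[OF assms(1), of x y] Qn_middle_sym[OF assms(1), of y z]
        Qn_middle_sym[OF assms(1), of z x]
      by (auto simp: fun_eq_iff algebra_simps)
  qed (use left right in \<open>auto simp: Vector_Spaces.linear_iff\<close>)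
qed

lemma Qn_unit_brackets:
  assumes "odd n" "n > 3"
  shows "lie_algebra.Qn_brackets fun_scale (Qn_bracket n) n unit_fun"
proof -
  interpret lie_algebra fun_scale "Qn_bracket n" by (rule Qn_lie_algebra[OF assms])
  have sum_unit: "(\<Sum>i=1..n-1. (-1) ^ i * unit_fun j i * unit_fun k (n - i)) =
      (if j \<in> {1..n-1} \<and> k = n - j then (-1) ^ j else 0)" for j k
  proof -
    have "(\<Sum>i=1..n-1. (-1) ^ i * unit_fun j i * unit_fun k (n - i))
      = (\<Sum>i=1..n-1. if i = j then (-1) ^ j * unit_fun k (n - j) else 0)"
      by (rule sum.cong) (auto simp: unit_fun_def)
    then show ?thesis by (auto simp: unit_fun_def)
  qed
  have val: "Qn_bracket n (unit_fun j) (unit_fun k) i =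
     (if 2 \<le> i \<and> i \<le> n - 1
        then (if j = 0 \<and> k = i - 1 then 1 else 0) - (if k = 0 \<and> j = i - 1 then 1 else 0)
      else if i = n then (if j \<in> {1..n-1} \<and> k = n - j then (-1) ^ j else 0) else 0)" for i j k
    unfolding Qn_bracket_def sum_unit by (auto simp: unit_fun_def)
  show ?thesis
    unfolding Qn_brackets_def
  proof (intro conjI ballI impI)
    fix j assume "j \<in> {1..n-2}"
    then show "Qn_bracket n (unit_fun 0) (unit_fun j) = unit_fun (j + 1)"
      unfolding fun_eq_iff val using assms by (auto simp: unit_fun_def)
  next
    fix j assume "j \<in> {1..n-1}"
    then show "Qn_bracket n (unit_fun j) (unit_fun (n - j)) = fun_scale ((-1) ^ j) (unit_fun n)"
      unfolding fun_eq_iff val using assms by (auto simp: unit_fun_def fun_scale_def)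
  next
    fix j k
    assume "\<not> (j = 0 \<and> k \<in> {1..n-2})" "\<not> (k = 0 \<and> j \<in> {1..n-2})"
      "\<not> (j \<in> {1..n-1} \<and> k = n - j)"
    then show "Qn_bracket n (unit_fun j) (unit_fun k) = 0"
      unfolding fun_eq_iff val using assms by auto
  qed
qed

lemma Qn_unit_basis:
  assumes "odd n" "n > 3"
  shows "lie_algebra.basis_family fun_scale {0..n} unit_fun (Qn_carrier n)"
proof -
  interpret lie_algebra fun_scale "Qn_bracket n" by (rule Qn_lie_algebra[OF assms])
  have inj: "inj_on unit_fun {0..n}"
    by (rule inj_onI) (metis unit_fun_def zero_neq_one)
  have expand: "(\<Sum>v\<in>unit_fun ` {0..n}. fun_scale (u v) v) k = (if k \<le> n then u (unit_fun k) else 0)" for u k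
  proof -
    have "(\<Sum>i\<in>A. F i) k = (\<Sum>i\<in>A. F i k)" if "finite A" for A and F :: "nat \<Rightarrow> nat \<Rightarrow> complex"
      using that by induction auto
    then have "(\<Sum>v\<in>unit_fun ` {0..n}. fun_scale (u v) v) k = (\<Sum>i=0..n. u (unit_fun i) * unit_fun i k)"
      using inj by (simp add: sum.reindex fun_scale_def)
    also have "\<dots> = (\<Sum>i=0..n. if i = k then u (unit_fun k) else 0)"
      by (rule sum.cong) (auto simp: unit_fun_def)
    finally show ?thesis by auto
  qed
  have "independent (unit_fun ` {0..n})"
  proof (rule independent_if_scalars_zero)
    fix u x assume "(\<Sum>v\<in>unit_fun ` {0..n}. fun_scale (u v) v) = 0" "x \<in> unit_fun ` {0..n}"
    then obtain k where "k \<le> n" "x = unit_fun k" by auto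
    with expand[of u k] \<open>_ = 0\<close> show "u x = 0" by simp
  qed simp
  moreover have "span (unit_fun ` {0..n}) = Qn_carrier n"
  proof
    show "span (unit_fun ` {0..n}) \<subseteq> Qn_carrier n"
      by (rule span_minimal)
         (auto simp: Qn_carrier_def unit_fun_def subspace_def fun_scale_def)
    show "Qn_carrier n \<subseteq> span (unit_fun ` {0..n})"
    proof
      fix f assume f: "f \<in> Qn_carrier n"
      define u where "u = (\<lambda>v. f (inv_into {0..n} unit_fun v))"
      have "u (unit_fun k) = f k" if "k \<le> n" for k
        using inj that by (simp add: u_def)
      then have "f = (\<Sum>v\<in>unit_fun ` {0..n}. fun_scale (u v) v)"
        using f by (auto simp: fun_eq_iff expand Qn_carrier_def)
      also have "\<dots> \<in> span (unit_fun ` {0..n})"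
        by (intro span_sum span_scale span_base)
      finally show "f \<in> span (unit_fun ` {0..n})" .
    qed
  qed
  ultimately show ?thesis using inj by (simp add: basis_family_def)
qed

lemma Qn_subalgebra:
  assumes "odd n" "n > 3"
  shows "lie_algebra.subalgebra fun_scale (Qn_bracket n) (Qn_carrier n)"
proof -
  interpret lie_algebra fun_scale "Qn_bracket n" by (rule Qn_lie_algebra[OF assms])
  show ?thesis
    by (auto simp: subalgebra_def subspace_def Qn_carrier_def Qn_bracket_def fun_scale_def)
qed

context lie_algebra
begin

definition quasi_Qn_filiform :: "nat \<Rightarrow> nat \<Rightarrow> nat \<Rightarrow> (nat \<Rightarrow> 'a set) \<Rightarrow> bool" where
  "quasi_Qn_filiform n m r N \<longleftrightarrow>
     1 \<le> m \<and>
     UNIV = {\<Sum>i=1..m. x i | x. \<forall>i\<in>{1..m}. x i \<in> N i} \<and>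
     (\<forall>i\<in>{1..m}. subalgebra (N i) \<and>
        lie_isomorphic_on scale bracket (N i) fun_scale (Qn_bracket n) (Qn_carrier n)) \<and>
     (\<forall>i\<in>{1..m}. \<forall>j\<in>{1..m}. i \<noteq> j \<longrightarrow> (\<forall>x\<in>N i. \<forall>y\<in>N j. bracket x y = 0)) \<and>
     r = dim (central_series (n - 1))"

text \<open>
  \<open>N\<close> consists of the bracket-commuting summands \<open>N 1, \<dots>, N m\<close>; only the \<open>e i n\<close> may be
  linearly dependent, and the numbering is such that \<open>e 1 n, \<dots>, e r n\<close> are independent.
  The last condition contains the linear independence of the \<open>e i j\<close> with \<open>j < n\<close>.
\<close>

definition adapted_elements ::
  "nat \<Rightarrow> nat \<Rightarrow> nat \<Rightarrow> (nat \<Rightarrow> 'a set) \<Rightarrow> (nat \<Rightarrow> nat \<Rightarrow> 'a) \<Rightarrow> bool" where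
  "adapted_elements n m r N e \<longleftrightarrow>
     (\<forall>i\<in>{1..m}. basis_family {0..n} (e i) (N i) \<and> Qn_brackets n (e i)) \<and>
     central_series (n - 1) = span {e i n | i. i \<in> {1..m}} \<and>
     basis_family ({1..m} \<times> {0..n-1} \<union> {1..r} \<times> {n}) (\<lambda>(i, j). e i j) UNIV"

end

end

theory Submission imports Defs begin

text \<open>
  Since the summands commute, bracketing an arbitrary \<open>x\<close> with \<open>e p q\<close> only sees the coordinates
  of \<open>x\<close> along \<open>N p\<close>, so a vanishing bracket of basis elements constrains the coordinates of their
  images under a derivation: the bracket with \<open>e p (n - j)\<close> detects the coordinate \<open>j\<close> through the
  nonzero central element \<open>e p n\<close>.  The brackets of \<open>e s 0\<close> with \<open>N p\<close> and with \<open>e s (n - 1)\<close> give (ii), those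
  of \<open>e s 1\<close> with \<open>N p\<close> and \<open>e s 2\<close> give (iii), \<open>[e s 1, e s (n - i)] = 0\<close> gives (iv) and
  \<open>[e s 1, e p 1] = 0\<close> gives (v).  By the recursion, \<open>\<delta>\<close> acts on the higher \<open>e s t\<close> by shifting the
  coordinates of \<open>\<delta> (e s 1)\<close> by \<open>t - 1\<close> and adding \<open>(t - 1) c\<close> on the diagonal, where \<open>c\<close> is the
  coefficient of \<open>e s 0\<close> in \<open>\<delta> (e s 0)\<close>.  Hence \<open>\<delta>\<close> scales \<open>e s n\<close> by \<open>\<lambda>\<^sub>s\<close>, and (i) is the
  compatibility with \<open>e s n = \<Sum>j b s j e j n\<close>.  Conversely these conditions make the Leibniz rule
  hold on every pair of basis elements.
\<close>

text \<open>The hypotheses are stated on the elements \<open>e i j\<close> alone, without the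
  summands; \<open>r_le\<close> comes later from a dimension count and \<open>nonzero\<close> from
  the independence of each family \<open>e i\<close>.\<close>

locale Qn_sum = lie_algebra scale bracket
  for scale :: "complex \<Rightarrow> 'a::ab_group_add \<Rightarrow> 'a" and bracket :: "'a \<Rightarrow> 'a \<Rightarrow> 'a" +
  fixes n m r :: nat and e :: "nat \<Rightarrow> nat \<Rightarrow> 'a" and b :: "nat \<Rightarrow> nat \<Rightarrow> complex"
  assumes odd_n: "odd n" and n_gt: "n > 3" and r_le: "r \<le> m"
    and Qn: "i \<in> {1..m} \<Longrightarrow> Qn_brackets n (e i)"
    and commute: "\<lbrakk>i \<in> {1..m}; k \<in> {1..m}; i \<noteq> k; j \<le> n; l \<le> n\<rbrakk> \<Longrightarrow> bracket (e i j) (e k l) = 0"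
    and nonzero: "i \<in> {1..m} \<Longrightarrow> e i n \<noteq> 0"
    and basis: "basis_family ({1..m} \<times> {0..n-1} \<union> {1..r} \<times> {n}) (\<lambda>(i, j). e i j) UNIV"
    and top_expand: "i \<in> {1..m} \<Longrightarrow> e i n = (\<Sum>j=1..r. scale (b i j) (e j n))"
begin

section \<open>Coordinates in the fixed basis\<close>

abbreviation idx :: "(nat \<times> nat) set" where
  "idx \<equiv> {1..m} \<times> {0..n-1} \<union> {1..r} \<times> {n}"

text \<open>Meaningful only for \<open>(i, j) \<in> idx\<close>: for \<open>i > r\<close> the element \<open>e i n\<close> need not be in the basis.\<close>

definition coord :: "nat \<Rightarrow> nat \<Rightarrow> 'a \<Rightarrow> complex" where
  "coord i j x = representation ((\<lambda>(i, j). e i j) ` idx) x (e i j)"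

lemma indep: "independent ((\<lambda>(i, j). e i j) ` idx)"
  and span_UNIV: "span ((\<lambda>(i, j). e i j) ` idx) = UNIV"
  and inj_e: "inj_on (\<lambda>(i, j). e i j) idx"
  using basis by (auto simp: basis_family_def)

lemma coord_add: "coord i j (x + y) = coord i j x + coord i j y"
  and coord_scale: "coord i j (scale a x) = a * coord i j x"
  and coord_zero: "coord i j 0 = 0"
  and coord_minus: "coord i j (- x) = - coord i j x"
  and coord_diff: "coord i j (x - y) = coord i j x - coord i j y"
  unfolding coord_def
  using indep span_UNIV
  by (simp_all add: representation_add representation_scale representation_zero
      representation_neg representation_diff)

lemma coord_sum: "coord i j (\<Sum>k\<in>A. f k) = (\<Sum>k\<in>A. coord i j (f k))"
  by (induction A rule: infinite_finite_induct) (simp_all add: coord_add coord_zero)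

lemmas coord_linear = coord_add coord_scale coord_zero coord_minus coord_diff coord_sum

lemma coord_basis:
  assumes "(i, j) \<in> idx" "(k, l) \<in> idx"
  shows "coord i j (e k l) = (if i = k \<and> j = l then 1 else 0)"
proof -
  have "e k l \<in> (\<lambda>(i, j). e i j) ` idx" using assms(2) by force
  moreover have "e i j = e k l \<longleftrightarrow> i = k \<and> j = l"
    using inj_onD[OF inj_e, of "(i, j)" "(k, l)"] assms by auto
  ultimately show ?thesis
    unfolding coord_def by (subst representation_basis[OF indep]) auto
qed

text \<open>Expanding by \<open>top_expand\<close> treats all \<open>k\<close> alike, whether or not
  \<open>e k n\<close> is one of the basis elements; for \<open>k \<le> r\<close> uniqueness of
  coordinates makes the row \<open>b k\<close> a unit vector.\<close>

lemma coord_top: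
  assumes "(i, j) \<in> idx" "k \<in> {1..m}"
  shows "coord i j (e k n) = (if j = n then b k i else 0)"
proof -
  have "coord i j (e k n) = (\<Sum>l=1..r. b k l * coord i j (e l n))"
    by (subst top_expand[OF assms(2)]) (simp add: coord_linear)
  also have "\<dots> = (\<Sum>l=1..r. if i = l then (if j = n then b k l else 0) else 0)"
    using assms(1) by (intro sum.cong refl) (simp add: coord_basis)
  also have "\<dots> = (if j = n then b k i else 0)"
    using assms(1) n_gt by auto
  finally show ?thesis .
qed

lemma coord_low:
  assumes "i \<in> {1..m}" "j < n" "k \<in> {1..m}" "l \<le> n"
  shows "coord i j (e k l) = (if i = k \<and> j = l then 1 else 0)"
  using assms coord_basis[of i j k l] coord_top[of i j k] n_gt
  by (cases "l = n") auto

lemma coord_high: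
  assumes "i \<in> {1..r}" "k \<in> {1..m}" "l \<le> n"
  shows "coord i n (e k l) = (if l = n then b k i else 0)"
  using assms coord_basis[of i n k l] coord_top[of i n k] n_gt
  by (cases "l = n") auto

text \<open>Serves to prove identities linear in \<open>x\<close> by checking them on the
  basis.\<close>

lemma basis_induct [case_names zero add scale basis]:
  assumes "P 0" "\<And>x y. P x \<Longrightarrow> P y \<Longrightarrow> P (x + y)" "\<And>a x. P x \<Longrightarrow> P (scale a x)"
    and "\<And>i j. i \<in> {1..m} \<Longrightarrow> j \<le> n \<Longrightarrow> j < n \<or> i \<le> r \<Longrightarrow> P (e i j)"
  shows "P x"
proof (rule span_induct[where S = "(\<lambda>(i, j). e i j) ` idx" and P = P])
  show "x \<in> span ((\<lambda>(i, j). e i j) ` idx)" by (simp only: span_UNIV UNIV_I)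
  show "subspace (Collect P)" using assms(1-3) by (simp add: subspace_def)
  show "P y" if y: "y \<in> (\<lambda>(i, j). e i j) ` idx" for y
  proof -
    from y obtain i j where ij: "y = e i j" "(i, j) \<in> idx" by auto
    then have "i \<in> {1..m}" "j \<le> n" "j < n \<or> i \<le> r" using r_le n_gt by auto
    then show ?thesis using assms(4) ij(1) by blast
  qed
qed

lemma coord_eqI:
  assumes "\<And>i j. i \<in> {1..m} \<Longrightarrow> j < n \<Longrightarrow> coord i j x = coord i j y"
    and "\<And>i. i \<in> {1..r} \<Longrightarrow> coord i n x = coord i n y"
  shows "x = y"
proof -
  let ?B = "(\<lambda>(i, j). e i j) ` idx"
  have "representation ?B x v = representation ?B y v" for v
  proof (cases "v \<in> ?B")
    case True
    then obtain i j where "v = e i j" "(i, j) \<in> idx" by auto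
    then show ?thesis using assms(1)[of i j] assms(2)[of i] n_gt by (auto simp: coord_def)
  next
    case False
    then show ?thesis using representation_ne_zero by metis
  qed
  then have eq: "representation ?B x = representation ?B y" by (rule ext)
  have expand: "(\<Sum>v | representation ?B z v \<noteq> 0. scale (representation ?B z v) v) = z" for z
    by (rule sum_nonzero_representation_eq[OF indep]) (simp only: span_UNIV UNIV_I)
  have "x = (\<Sum>v | representation ?B x v \<noteq> 0. scale (representation ?B x v) v)"
    by (rule expand[symmetric])
  also have "\<dots> = y" unfolding eq by (rule expand)
  finally show ?thesis .
qed

section \<open>The normal forms (ii) and (iii) in coordinates\<close>

lemma coord_row:
  assumes "(p, q) \<in> idx" "finite A" "\<And>j. j \<in> A \<Longrightarrow> (k, j) \<in> idx"
  shows "coord p q (\<Sum>j\<in>A. scale (f j) (e k j)) = (if p = k \<and> q \<in> A then f q else 0)"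
proof -
  have "coord p q (\<Sum>j\<in>A. scale (f j) (e k j)) = (\<Sum>j\<in>A. if j = q then (if p = k then f q else 0) else 0)"
    unfolding coord_sum coord_scale
    by (intro sum.cong refl) (subst coord_basis[OF assms(1) assms(3)], auto)
  then show ?thesis using assms(2) by simp
qed

lemma coord_column:
  assumes "(p, q) \<in> idx" "finite A" "\<And>i. i \<in> A \<Longrightarrow> (i, l) \<in> idx"
  shows "coord p q (\<Sum>i\<in>A. scale (f i) (e i l)) = (if q = l \<and> p \<in> A then f p else 0)"
proof -
  have "coord p q (\<Sum>i\<in>A. scale (f i) (e i l)) = (\<Sum>i\<in>A. if i = p then (if q = l then f p else 0) else 0)"
    unfolding coord_sum coord_scale
    by (intro sum.cong refl) (subst coord_basis[OF assms(1) assms(3)], auto)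
  then show ?thesis using assms(2) by simp
qed

text \<open>Lets the coefficients \<open>c s t i j\<close> of the theorem be read as coordinates of
  \<open>\<delta> (e s t)\<close>.\<close>

lemma coord_expansion:
  assumes pq: "(p, q) \<in> idx"
  shows "coord p q ((\<Sum>i=1..m. \<Sum>j=0..n-1. scale (f i j) (e i j)) + (\<Sum>i=1..r. scale (f i n) (e i n))) = f p q"
proof -
  have "coord p q (\<Sum>i=1..m. \<Sum>j=0..n-1. scale (f i j) (e i j))
      = (\<Sum>i=1..m. if i = p then (if q \<in> {0..n-1} then f p q else 0) else 0)"
    unfolding coord_sum[of p q _ "{1..m}"]
    by (intro sum.cong refl) (subst coord_row[OF pq], auto)
  moreover have "coord p q (\<Sum>i=1..r. scale (f i n) (e i n)) = (if q = n \<and> p \<in> {1..r} then f p n else 0)"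
    by (rule coord_column[OF pq]) auto
  ultimately show ?thesis using pq n_gt r_le by (auto simp: coord_add)
qed

lemma coord_eq_iff: "x = y \<longleftrightarrow> (\<forall>(p, q)\<in>idx. coord p q x = coord p q y)"
  using coord_eqI[of x y] n_gt by fastforce

text \<open>Both sides agree automatically at every position that occurs on the right, so only the
  missing positions below \<open>n\<close> impose something: all other summands, and position 1 of
  summand \<open>s\<close>.\<close>

lemma expansion0_iff:
  assumes s: "s \<in> {1..m}" and f: "\<And>i j. (i, j) \<in> idx \<Longrightarrow> coord i j x = f i j"
  shows "x = scale (f s 0) (e s 0) + (\<Sum>i=2..n-1. scale (f s i) (e s i)) + (\<Sum>i=1..r. scale (f i n) (e i n))
    \<longleftrightarrow> (\<forall>p\<in>{1..m}. \<forall>j<n. p \<noteq> s \<or> j = 1 \<longrightarrow> f p j = 0)" (is "x = ?y \<longleftrightarrow> ?R")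
proof -
  have y: "coord p q ?y = (if p = s \<and> q = 0 then f s 0 else 0) + (if p = s \<and> q \<in> {2..n-1} then f s q else 0)
      + (if q = n \<and> p \<in> {1..r} then f p n else 0)" if pq: "(p, q) \<in> idx" for p q
  proof -
    have "coord p q (e s 0) = (if p = s \<and> q = 0 then 1 else 0)"
      using s by (subst coord_basis[OF pq]) auto
    moreover have "coord p q (\<Sum>i=2..n-1. scale (f s i) (e s i)) = (if p = s \<and> q \<in> {2..n-1} then f s q else 0)"
      using s by (intro coord_row[OF pq]) auto
    moreover have "coord p q (\<Sum>i=1..r. scale (f i n) (e i n)) = (if q = n \<and> p \<in> {1..r} then f p n else 0)"
      by (rule coord_column[OF pq]) auto
    ultimately show ?thesis by (simp only: coord_add coord_scale) simp
  qed
  have "coord p q x = coord p q ?y \<longleftrightarrow> (q < n \<longrightarrow> p \<noteq> s \<or> q = 1 \<longrightarrow> f p q = 0)" if pq: "(p, q) \<in> idx" for p q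
    unfolding y[OF pq] f[OF pq] using pq n_gt by auto
  then have "x = ?y \<longleftrightarrow> (\<forall>(p, q)\<in>idx. q < n \<longrightarrow> p \<noteq> s \<or> q = 1 \<longrightarrow> f p q = 0)"
    unfolding coord_eq_iff[of x] split_def
    by (intro ball_cong refl) (simp only: prod.collapse)
  also have "\<dots> \<longleftrightarrow> ?R" using n_gt by fastforce
  finally show ?thesis .
qed

text \<open>As in \<open>expansion0_iff\<close>; the missing positions below \<open>n\<close> are
  now 0 in summand \<open>s\<close> and all but \<open>n - 1\<close> in the others.\<close>

lemma expansion1_iff:
  assumes s: "s \<in> {1..m}" and f: "\<And>i j. (i, j) \<in> idx \<Longrightarrow> coord i j x = f i j"
  shows "x = (\<Sum>i=1..n-2. scale (f s i) (e s i)) + (\<Sum>i=1..m. scale (f i (n - 1)) (e i (n - 1)))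
      + (\<Sum>i=1..r. scale (f i n) (e i n))
    \<longleftrightarrow> (\<forall>p\<in>{1..m}. \<forall>j<n. (if p = s then j = 0 else j < n - 1) \<longrightarrow> f p j = 0)" (is "x = ?y \<longleftrightarrow> ?R")
proof -
  have y: "coord p q ?y = (if p = s \<and> q \<in> {1..n-2} then f s q else 0)
      + (if q = n - 1 \<and> p \<in> {1..m} then f p (n - 1) else 0)
      + (if q = n \<and> p \<in> {1..r} then f p n else 0)" if pq: "(p, q) \<in> idx" for p q
  proof -
    have "coord p q (\<Sum>i=1..n-2. scale (f s i) (e s i)) = (if p = s \<and> q \<in> {1..n-2} then f s q else 0)"
      using s by (intro coord_row[OF pq]) auto
    moreover have "coord p q (\<Sum>i=1..m. scale (f i (n - 1)) (e i (n - 1)))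
        = (if q = n - 1 \<and> p \<in> {1..m} then f p (n - 1) else 0)"
      by (rule coord_column[OF pq]) auto
    moreover have "coord p q (\<Sum>i=1..r. scale (f i n) (e i n)) = (if q = n \<and> p \<in> {1..r} then f p n else 0)"
      by (rule coord_column[OF pq]) auto
    ultimately show ?thesis by (simp only: coord_add)
  qed
  have "coord p q x = coord p q ?y \<longleftrightarrow>
      (q < n \<longrightarrow> (if p = s then q = 0 else q < n - 1) \<longrightarrow> f p q = 0)" if pq: "(p, q) \<in> idx" for p q
    unfolding y[OF pq] f[OF pq] using pq n_gt by auto
  then have "x = ?y \<longleftrightarrow> (\<forall>(p, q)\<in>idx. q < n \<longrightarrow> (if p = s then q = 0 else q < n - 1) \<longrightarrow> f p q = 0)"
    unfolding coord_eq_iff[of x] split_def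
    by (intro ball_cong refl) (simp only: prod.collapse)
  also have "\<dots> \<longleftrightarrow> ?R" using n_gt by fastforce
  finally show ?thesis .
qed

text \<open>Otherwise the whole row \<open>b p\<close> would vanish, and with it
  \<open>e p n\<close>.\<close>

lemma top_coeff_zero:
  assumes "p \<in> {1..m}" and "\<And>i. i \<in> {1..r} \<Longrightarrow> a * b p i = 0"
  shows "a = 0"
proof (rule ccontr)
  assume "a \<noteq> 0"
  then have "b p i = 0" if "i \<in> {1..r}" for i
    using assms that by auto
  then have "e p n = 0" using top_expand[OF assms(1)] by simp
  then show False using nonzero[OF assms(1)] by simp
qed

subsection \<open>The bracket in coordinates\<close>

lemma bracket_add_left: "bracket (x + y) z = bracket x z + bracket y z"
  and bracket_add_right: "bracket z (x + y) = bracket z x + bracket z y"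
  and bracket_scale_left: "bracket (scale a x) z = scale a (bracket x z)"
  and bracket_scale_right: "bracket z (scale a x) = scale a (bracket z x)"
  using linear_bracket_left linear_bracket_right by (auto simp: Vector_Spaces.linear_iff)

lemma bracket_zero_left: "bracket 0 z = 0"
  and bracket_zero_right: "bracket z 0 = 0"
  using bracket_scale_left[of 0 0 z] bracket_scale_right[of z 0 0] by simp_all

lemma bracket_swap: "bracket x y = - bracket y x"
proof -
  have "bracket (x + y) (x + y) = bracket x y + bracket y x"
    by (simp only: bracket_add_left bracket_add_right) (simp add: bracket_self)
  then show ?thesis by (simp add: bracket_self eq_neg_iff_add_eq_0)
qed

lemma table_0:
  assumes "i \<in> {1..m}" "j \<in> {1..n-2}"
  shows "bracket (e i 0) (e i j) = e i (j + 1)"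
  using Qn[OF assms(1)] assms(2) by (auto simp: Qn_brackets_def)

lemma table_n:
  assumes "i \<in> {1..m}" "j \<in> {1..n-1}"
  shows "bracket (e i j) (e i (n - j)) = scale ((-1) ^ j) (e i n)"
  using Qn[OF assms(1)] assms(2) by (auto simp: Qn_brackets_def)

lemma table_zero:
  assumes "i \<in> {1..m}" "j \<le> n" "k \<le> n" "\<not> (j = 0 \<and> k \<in> {1..n-2})" "\<not> (k = 0 \<and> j \<in> {1..n-2})"
    "\<not> (j \<in> {1..n-1} \<and> k = n - j)"
  shows "bracket (e i j) (e i k) = 0"
  using Qn[OF assms(1)] assms(2-) unfolding Qn_brackets_def by auto

text \<open>Only the part of \<open>x\<close> in summand \<open>p\<close> survives, shifted up by
  one; the sign is antisymmetry, and the sum stops at \<open>n - 2\<close> because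
  \<open>e p 0\<close> commutes with \<open>e p (n - 1)\<close>.\<close>

lemma bracket_e0:
  assumes p: "p \<in> {1..m}"
  shows "bracket x (e p 0) = - (\<Sum>j=1..n-2. scale (coord p j x) (e p (j + 1)))"
proof (induction x rule: basis_induct)
  case zero then show ?case by (simp add: bracket_zero_left coord_zero)
next
  case (add x y) then show ?case
    by (simp add: bracket_add_left coord_add scale_left_distrib sum.distrib)
next
  case (scale a x) then show ?case
    by (simp add: bracket_scale_left coord_scale scale_sum_right scale_minus_right flip: scale_scale)
next
  case (basis i j)
  have "(\<Sum>k=1..n-2. scale (coord p k (e i j)) (e p (k + 1)))
      = (\<Sum>k=1..n-2. if k = j then (if i = p then e p (j + 1) else 0) else 0)"
    using basis p by (intro sum.cong refl) (auto simp: coord_low)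
  also have "\<dots> = (if i = p \<and> j \<in> {1..n-2} then e p (j + 1) else 0)" by auto
  finally have S: "(\<Sum>k=1..n-2. scale (coord p k (e i j)) (e p (k + 1)))
      = (if i = p \<and> j \<in> {1..n-2} then e p (j + 1) else 0)" .
  show ?case
  proof (cases "i = p \<and> j \<in> {1..n-2}")
    case True then show ?thesis
      unfolding S using table_0[OF p, of j] bracket_swap[of "e p j" "e p 0"] by simp
  next
    case False
    then have "bracket (e i j) (e p 0) = 0"
    proof (cases "i = p")
      case True
      moreover have "bracket (e p j) (e p 0) = 0"
        by (rule table_zero[OF p]) (use False True basis n_gt in auto)
      ultimately show ?thesis by simp
    qed (use basis p commute in auto)
    then show ?thesis unfolding S using False by auto
  qed
qed

text \<open>Two coordinates of \<open>x\<close> matter: the one at \<open>e p 0\<close>, which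
  shifts \<open>e p q\<close>, and the one at the partner \<open>e p (n - q)\<close>. The shift is
  switched off at \<open>q = n - 1\<close>, where \<open>q + 1\<close> would wrongly produce
  \<open>e p n\<close>.\<close>

lemma bracket_e:
  assumes p: "p \<in> {1..m}" and q: "q \<in> {1..n-1}"
  shows "bracket x (e p q) = scale (if q < n - 1 then coord p 0 x else 0) (e p (q + 1))
      + scale ((-1) ^ (n - q) * coord p (n - q) x) (e p n)"
proof (induction x rule: basis_induct)
  case zero then show ?case by (simp add: bracket_zero_left coord_zero)
next
  case (add x y) then show ?case
    by (simp add: bracket_add_left coord_add scale_left_distrib distrib_left)
next
  case (scale a x) then show ?case
    by (simp add: bracket_scale_left coord_scale scale_right_distrib mult.left_commute)
next
  case (basis i j)
  have c0: "coord p 0 (e i j) = (if p = i \<and> j = 0 then 1 else 0)"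
    and c1: "coord p (n - q) (e i j) = (if p = i \<and> n - q = j then 1 else 0)"
    using p q basis n_gt by (auto simp: coord_low)
  show ?case
  proof (cases "i = p")
    case False
    then show ?thesis using p q basis commute[of i p j q] n_gt by (auto simp: c0 c1)
  next
    case [simp]: True
    consider "j = 0" | "j = n - q" | "j \<noteq> 0" "j \<noteq> n - q" by blast
    then show ?thesis
    proof cases
      case 1
      then show ?thesis using p q n_gt table_0[OF p, of q] table_zero[OF p, of 0 q]
        by (cases "q < n - 1") (auto simp: coord_low)
    next
      case 2
      then show ?thesis using p q n_gt table_n[OF p, of j] by (auto simp: coord_low Suc_le_eq)
    next
      case 3
      then have "bracket (e p j) (e p q) = 0"
        using q basis by (intro table_zero[OF p]) auto
      then show ?thesis using 3 c0 c1 by simp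
    qed
  qed
qed

lemma bracket_top:
  assumes p: "p \<in> {1..m}"
  shows "bracket x (e p n) = 0"
proof (induction x rule: basis_induct)
  case (basis i j) then show ?case
    using p n_gt commute[of i p j n] table_zero[OF p, of j n] by (cases "i = p") force+
qed (simp_all add: bracket_zero_left bracket_add_left bracket_scale_left)

lemma low_coord_bracket_e:
  assumes "p \<in> {1..m}" "q \<in> {1..n-1}" "i \<in> {1..m}" "j < n"
  shows "coord i j (bracket x (e p q)) = (if i = p \<and> j = q + 1 then coord p 0 x else 0)"
  using assms by (auto simp: bracket_e coord_linear coord_low)

lemma low_coord_bracket_e0:
  assumes p: "p \<in> {1..m}" and "i \<in> {1..m}" "j < n"
  shows "coord i j (bracket x (e p 0)) = (if i = p \<and> 2 \<le> j then - coord p (j - 1) x else 0)"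
proof -
  have "coord i j (bracket x (e p 0))
      = - (\<Sum>k=1..n-2. if k = j - 1 then (if i = p \<and> 2 \<le> j then coord p (j - 1) x else 0) else 0)"
    unfolding bracket_e0[OF p] coord_minus coord_sum
    using assms by (intro arg_cong[of _ _ uminus] sum.cong refl)
      (auto simp: coord_scale coord_low split: if_splits)
  also have "\<dots> = (if i = p \<and> 2 \<le> j then - coord p (j - 1) x else 0)"
    using assms by auto
  finally show ?thesis .
qed

lemma high_coord_bracket_e:
  assumes "p \<in> {1..m}" "q \<in> {1..n-1}" "i \<in> {1..r}"
  shows "coord i n (bracket x (e p q)) = (-1) ^ (n - q) * coord p (n - q) x * b p i"
  using assms by (auto simp: bracket_e coord_linear coord_high)

lemma high_coord_bracket_e0:
  assumes "p \<in> {1..m}" "i \<in> {1..r}"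
  shows "coord i n (bracket x (e p 0)) = 0"
proof -
  have "(\<Sum>k=1..n-2. coord i n (scale (coord p k x) (e p (k + 1)))) = 0"
    using assms n_gt by (intro sum.neutral) (auto simp: coord_scale coord_high split: if_splits)
  then show ?thesis by (simp add: bracket_e0[OF assms(1)] coord_minus coord_sum)
qed

text \<open>The \<open>n\<close>-coordinates of this bracket are, up to sign,
  \<open>coord p j x\<close> times the nonzero row \<open>b p\<close>.\<close>

lemma top_coord_zero:
  assumes p: "p \<in> {1..m}" and j: "j \<in> {1..n-1}"
    and zero: "\<And>i. i \<in> {1..r} \<Longrightarrow> coord i n (bracket x (e p (n - j))) = 0"
  shows "coord p j x = 0"
proof (rule top_coeff_zero[OF p])
  fix i assume i: "i \<in> {1..r}"
  have q: "n - j \<in> {1..n-1}" "n - (n - j) = j" using j by auto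
  have "(-1) ^ j * coord p j x * b p i = 0"
    using zero[OF i] high_coord_bracket_e[OF p q(1) i, of x] unfolding q(2) by simp
  then show "coord p j x * b p i = 0" by simp
qed

end

subsection \<open>Maps determined by their values on generators\<close>

text \<open>The values at \<open>e s 0\<close> and \<open>e s 1\<close> are free.
  \<open>delta_n\<close> covers only \<open>s \<le> r\<close>; for larger \<open>s\<close> linearity
  already fixes the value at \<open>e s n\<close>.\<close>

locale Qn_sum_map = Qn_sum scale bracket n m r e b
  for scale :: "complex \<Rightarrow> 'a::ab_group_add \<Rightarrow> 'a" and bracket :: "'a \<Rightarrow> 'a \<Rightarrow> 'a"
    and n m r e b +
  fixes \<delta> :: "'a \<Rightarrow> 'a"
  assumes linear: "Vector_Spaces.linear scale scale \<delta>"
    and delta_rec: "\<lbrakk>s \<in> {1..m}; t \<in> {2..n-1}\<rbrakk> \<Longrightarrow> \<delta> (e s t) =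
        bracket (\<delta> (e s 0)) (e s (t - 1)) + bracket (e s 0) (\<delta> (e s (t - 1)))"
    and delta_n: "s \<in> {1..r} \<Longrightarrow> \<delta> (e s n) =
        - bracket (\<delta> (e s 1)) (e s (n - 1)) - bracket (e s 1) (\<delta> (e s (n - 1)))"
begin

abbreviation K :: "nat \<Rightarrow> nat \<Rightarrow> nat \<Rightarrow> nat \<Rightarrow> complex" where
  "K s t i j \<equiv> coord i j (\<delta> (e s t))"

text \<open>The number lambda_s; under the assumptions of \<open>delta_top\<close> it is the factor
  by which \<open>\<delta>\<close> scales \<open>e s n\<close>.\<close>

definition weight :: "nat \<Rightarrow> complex" where
  "weight s = of_nat (n - 2) * K s 0 s 0 + 2 * K s 1 s 1"

text \<open>This and \<open>reduced1\<close> are (ii) and (iii) as vanishing of the forbidden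
  coordinates; \<open>expansion0_iff\<close> and \<open>expansion1_iff\<close> give the
  equivalence.\<close>

definition reduced0 :: "nat \<Rightarrow> bool" where
  "reduced0 s \<longleftrightarrow> (\<forall>p\<in>{1..m}. \<forall>j<n. p \<noteq> s \<or> j = 1 \<longrightarrow> K s 0 p j = 0)"

definition reduced1 :: "nat \<Rightarrow> bool" where
  "reduced1 s \<longleftrightarrow> (\<forall>p\<in>{1..m}. \<forall>j<n. (if p = s then j = 0 else j < n - 1) \<longrightarrow> K s 1 p j = 0)"

lemma delta_linear:
  "\<delta> (x + y) = \<delta> x + \<delta> y" "\<delta> (scale a x) = scale a (\<delta> x)" "\<delta> 0 = 0"
  "\<delta> (- x) = - \<delta> x"
proof -
  show *: "\<delta> (x + y) = \<delta> x + \<delta> y" "\<delta> (scale a x) = scale a (\<delta> x)" for x y a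
    using linear by (auto simp: Vector_Spaces.linear_iff)
  show "\<delta> 0 = 0" using *(2)[of 0 0] by simp
  show "\<delta> (- x) = - \<delta> x" using *(2)[of "-1" x] by simp
qed

lemma delta_sum: "\<delta> (\<Sum>k\<in>A. f k) = (\<Sum>k\<in>A. \<delta> (f k))"
  by (induction A rule: infinite_finite_induct) (simp_all add: delta_linear)

text \<open>In \<open>delta_rec\<close> the first bracket contributes only on the diagonal below the
  top, and the second shifts by one inside summand \<open>s\<close>. So for \<open>t \<ge> 2\<close>
  no other summand is met below the top.\<close>

lemma coeff_rec:
  assumes "s \<in> {1..m}" "t \<in> {2..n-1}" "i \<in> {1..m}" "j < n"
  shows "K s t i j = (if i = s \<and> 2 \<le> j then K s (t - 1) s (j - 1) + (if j = t then K s 0 s 0 else 0) else 0)"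
proof -
  have "\<delta> (e s t) = bracket (\<delta> (e s 0)) (e s (t - 1)) - bracket (\<delta> (e s (t - 1))) (e s 0)"
    using delta_rec[OF assms(1,2)] bracket_swap[of "e s 0" "\<delta> (e s (t - 1))"] by simp
  moreover have "t - 1 \<in> {1..n-1}" using assms by auto
  ultimately show ?thesis
    using assms by (auto simp: coord_diff low_coord_bracket_e low_coord_bracket_e0)
qed

text \<open>Iterates \<open>coeff_rec\<close>: each step shifts by one and adds
  \<open>K s 0 s 0\<close> on the diagonal. \<open>K0\<close> settles \<open>t = 1\<close>,
  \<open>j = 0\<close>.\<close>

lemma coeff_shift:
  assumes s: "s \<in> {1..m}" and K0: "K s 1 s 0 = 0" and "1 \<le> t" "t \<le> n - 1" "j < n"
  shows "K s t s j = (if j < t then 0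
    else K s 1 s (j - t + 1) + (if j = t then of_nat (t - 1) * K s 0 s 0 else 0))"
  using assms(3-)
proof (induction t arbitrary: j rule: nat_induct_at_least)
  case base
  then show ?case using K0 by (cases j) auto
next
  case (Suc t)
  show ?case
  proof (cases "2 \<le> j")
    case True
    have "K s (Suc t) s j = K s t s (j - 1) + (if j = Suc t then K s 0 s 0 else 0)"
      using coeff_rec[of s "Suc t" s j] s Suc True by simp
    also have "K s t s (j - 1) = (if j - 1 < t then 0
       else K s 1 s (j - 1 - t + 1) + (if j - 1 = t then of_nat (t - 1) * K s 0 s 0 else 0))"
      using Suc by (intro Suc.IH) auto
    finally show ?thesis using True Suc.hyps
      by (auto simp: algebra_simps of_nat_diff)
  next
    case False
    then show ?thesis using coeff_rec[of s "Suc t" s j] s Suc by simp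
  qed
qed

text \<open>The two brackets contribute \<open>K s 1 s 1\<close> and
  \<open>K s 1 s 1 + of_nat (n - 2) * K s 0 s 0\<close>. The formula \<open>top\<close> is a
  hypothesis so that it can come from \<open>delta_n\<close> or from the Leibniz rule.\<close>

lemma delta_top:
  assumes s: "s \<in> {1..m}" and K0: "K s 1 s 0 = 0"
    and top: "\<delta> (e s n) = - bracket (\<delta> (e s 1)) (e s (n - 1)) - bracket (e s 1) (\<delta> (e s (n - 1)))"
  shows "\<delta> (e s n) = scale (weight s) (e s n)"
proof -
  have "K s (n - 1) s 0 = 0" "K s (n - 1) s (n - 1) = K s 1 s 1 + of_nat (n - 2) * K s 0 s 0"
    using coeff_shift[OF s K0, of "n - 1"] n_gt by (auto simp: numeral_2_eq_2)
  moreover have "even (n - 1)" using odd_n by simp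
  ultimately have "bracket (\<delta> (e s (n - 1))) (e s 1) = scale (K s 1 s 1 + of_nat (n - 2) * K s 0 s 0) (e s n)"
    using n_gt by (subst bracket_e[OF s]) auto
  moreover have "bracket (\<delta> (e s 1)) (e s (n - 1)) = - scale (K s 1 s 1) (e s n)"
    using n_gt by (subst bracket_e[OF s]) auto
  ultimately show ?thesis
    unfolding top using bracket_swap[of "e s 1" "\<delta> (e s (n - 1))"]
    by (simp add: weight_def scale_left_distrib add.commute flip: scale_left_distrib)
qed

text \<open>Here \<open>e s n\<close> is expanded before \<open>\<delta>\<close> is applied, so the
  weights of the first \<open>r\<close> summands appear even when \<open>s > r\<close>.\<close>

lemma high_coord_delta_top:
  assumes red: "\<And>s. s \<in> {1..m} \<Longrightarrow> reduced1 s" and s: "s \<in> {1..m}" and i: "i \<in> {1..r}"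
  shows "coord i n (\<delta> (e s n)) = b s i * weight i"
proof -
  have top: "\<delta> (e j n) = scale (weight j) (e j n)" if j: "j \<in> {1..r}" for j
  proof (rule delta_top)
    show "j \<in> {1..m}" using j r_le by simp
    then show "K j 1 j 0 = 0" using red[of j] n_gt by (simp add: reduced1_def)
  qed (rule delta_n[OF j])
  have "\<delta> (e s n) = (\<Sum>j=1..r. scale (b s j) (\<delta> (e j n)))"
    by (subst top_expand[OF s]) (simp add: delta_sum delta_linear)
  then have "coord i n (\<delta> (e s n)) = (\<Sum>j=1..r. b s j * (weight j * coord i n (e j n)))"
    by (simp add: coord_sum coord_scale top mult.assoc)
  also have "\<dots> = (\<Sum>j=1..r. if j = i then b s i * weight i else 0)"
  proof (rule sum.cong[OF refl])
    fix j assume "j \<in> {1..r}"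
    then have "coord i n (e j n) = (if i = j then 1 else 0)"
      using i by (subst coord_basis) auto
    then show "b s j * (weight j * coord i n (e j n)) = (if j = i then b s i * weight i else 0)"
      by simp
  qed
  finally show ?thesis using i by simp
qed

section \<open>Necessity: commuting basis elements constrain the coordinates\<close>

lemma derivation_zero_bracket:
  assumes "derivation \<delta>" "bracket x y = 0"
  shows "bracket (\<delta> x) y = bracket (\<delta> y) x"
proof -
  have "bracket (\<delta> x) y + bracket x (\<delta> y) = 0"
    using assms delta_linear(3) unfolding derivation_def by metis
  \<comment> \<open>For basis elements \<open>x\<close> and \<open>y\<close>, both brackets now have
    a basis element on the right, where \<open>bracket_e\<close> and \<open>bracket_e0\<close>
    apply.\<close>
  then show ?thesis using bracket_swap[of x "\<delta> y"] by simp
qed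

lemma derivation_reduced0:
  assumes der: "derivation \<delta>" and s: "s \<in> {1..m}"
  shows "reduced0 s"
  unfolding reduced0_def
proof (intro ballI allI impI)
  fix p j assume p: "p \<in> {1..m}" and j: "j < n" and pj: "p \<noteq> s \<or> j = 1"
  show "K s 0 p j = 0"
  proof (cases "j = 0")
    case True
    then have "bracket (\<delta> (e s 0)) (e p 1) = bracket (\<delta> (e p 1)) (e s 0)"
      using pj s p n_gt by (intro derivation_zero_bracket[OF der] commute) auto
    \<comment> \<open>Here \<open>p \<noteq> s\<close>: the left side is \<open>K s 0 p 0\<close>,
      while the right side, a bracket with \<open>e s 0\<close>, has no low coordinate in summand
      \<open>p\<close>.\<close>
    then have "coord p 2 (bracket (\<delta> (e s 0)) (e p 1)) = coord p 2 (bracket (\<delta> (e p 1)) (e s 0))"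
      by simp
    then show ?thesis using s p n_gt pj True
      by (simp add: low_coord_bracket_e low_coord_bracket_e0)
  next
    case False
    \<comment> \<open>The partner of position \<open>j\<close> detects it, because brackets with
      \<open>e s 0\<close> have no top coordinates.\<close>
    have "bracket (e s 0) (e p (n - j)) = 0"
    proof (cases "p = s")
      case True
      then have "j = 1" using pj by simp
      then show ?thesis using True s n_gt by (auto intro!: table_zero)
    qed (use s p commute in auto)
    from derivation_zero_bracket[OF der this]
    have "coord i n (bracket (\<delta> (e s 0)) (e p (n - j))) = 0" if "i \<in> {1..r}" for i
      using high_coord_bracket_e0[OF s that] by simp
    then show ?thesis using top_coord_zero[OF p, of j] j False by simp
  qed
qed

lemma derivation_reduced1:
  assumes der: "derivation \<delta>" and s: "s \<in> {1..m}"
  shows "reduced1 s"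
  unfolding reduced1_def
proof (intro ballI allI impI)
  fix p j assume p: "p \<in> {1..m}" and j: "j < n" and pj: "if p = s then j = 0 else j < n - 1"
  consider "p = s" "j = 0" | "p \<noteq> s" "j = 0" | "p \<noteq> s" "1 \<le> j" "j < n - 1"
    using pj by (cases "p = s"; cases "j = 0") auto
  then show "K s 1 p j = 0"
  proof cases
    case 1
    have "n > 4" using n_gt odd_n by (cases "n = 4") auto
    have "bracket (\<delta> (e s 1)) (e s 2) = bracket (\<delta> (e s 2)) (e s 1)"
      using s \<open>n > 4\<close> by (intro derivation_zero_bracket[OF der] table_zero) auto
    \<comment> \<open>The left side is \<open>K s 1 s 0\<close>; below the top a bracket with
      \<open>e s 1\<close> only reaches \<open>e s 2\<close>.\<close>
    then have "coord s 3 (bracket (\<delta> (e s 1)) (e s 2)) = coord s 3 (bracket (\<delta> (e s 2)) (e s 1))"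
      by simp
    then show ?thesis using s \<open>n > 4\<close> 1 by (simp add: low_coord_bracket_e)
  next
    case 2
    then have "bracket (\<delta> (e s 1)) (e p 1) = bracket (\<delta> (e p 1)) (e s 1)"
      using s p n_gt by (intro derivation_zero_bracket[OF der] commute) auto
    then have "coord p 2 (bracket (\<delta> (e s 1)) (e p 1)) = coord p 2 (bracket (\<delta> (e p 1)) (e s 1))"
      by simp
    then show ?thesis using s p n_gt 2 by (simp add: low_coord_bracket_e)
  next
    case 3
    \<comment> \<open>From index 2 on \<open>coeff_rec\<close> applies to the partner. At
      \<open>j = n - 1\<close> the partner is \<open>e p 1\<close>, which leaves the coefficients of
      (v).\<close>
    have q: "n - j \<in> {2..n-1}" using 3 by auto
    have eq: "bracket (\<delta> (e s 1)) (e p (n - j)) = bracket (\<delta> (e p (n - j))) (e s 1)"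
      using 3 s p n_gt by (intro derivation_zero_bracket[OF der] commute) auto
    have "K p (n - j) s (n - 1) = 0"
      using coeff_rec[OF p q s, of "n - 1"] 3 n_gt by simp
    then have "coord i n (bracket (\<delta> (e s 1)) (e p (n - j))) = 0" if "i \<in> {1..r}" for i
      unfolding eq using s that n_gt by (simp add: high_coord_bracket_e)
    then show ?thesis using top_coord_zero[OF p, of j] 3 by simp
  qed
qed

text \<open>By \<open>coeff_shift\<close> the same coefficient appears on both sides of the relation
  from \<open>e s 1\<close> and \<open>e s (n - i)\<close>, with opposite signs exactly because
  \<open>i\<close> is odd.\<close>

lemma derivation_odd_coeff:
  assumes der: "derivation \<delta>" and s: "s \<in> {1..m}" and i: "i \<in> {3..n-2}" "odd i"
  shows "K s 1 s i = 0"
proof (rule top_coeff_zero[OF s])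
  fix j assume j: "j \<in> {1..r}"
  have K0: "K s 1 s 0 = 0"
    using derivation_reduced1[OF der s] s n_gt by (simp add: reduced1_def)
  have "bracket (\<delta> (e s 1)) (e s (n - i)) = bracket (\<delta> (e s (n - i))) (e s 1)"
    using s i by (intro derivation_zero_bracket[OF der] table_zero) auto
  then have "coord j n (bracket (\<delta> (e s 1)) (e s (n - i))) = coord j n (bracket (\<delta> (e s (n - i))) (e s 1))"
    by simp
  moreover have "coord j n (bracket (\<delta> (e s 1)) (e s (n - i))) = - (K s 1 s i * b s j)"
  proof -
    have "n - (n - i) = i" "n - i \<in> {1..n-1}" using i by auto
    then show ?thesis using i(2) by (simp only: high_coord_bracket_e[OF s _ j]) simp
  qed
  moreover have "coord j n (bracket (\<delta> (e s (n - i))) (e s 1)) = K s 1 s i * b s j"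
  proof -
    have "K s (n - i) s (n - 1) = K s 1 s i"
      using coeff_shift[OF s K0, of "n - i" "n - 1"] i by auto
    moreover have "even (n - 1)" using odd_n by simp
    ultimately show ?thesis using n_gt by (simp add: high_coord_bracket_e[OF s _ j])
  qed
  ultimately have neg: "- (K s 1 s i * b s j) = K s 1 s i * b s j" by (metis (no_types))
  have "2 * x = 0" if "- x = x" for x :: complex
    using that by (metis mult_2 neg_eq_iff_add_eq_0)
  from this[OF neg] show "K s 1 s i * b s j = 0" by simp
qed

text \<open>The relation from \<open>e s 1\<close> and \<open>e p 1\<close> equates a multiple of
  \<open>e p n\<close> with a multiple of \<open>e s n\<close>. These may be dependent, so the
  coefficients need not vanish.\<close>

lemma derivation_cross_coeff:
  assumes der: "derivation \<delta>" and s: "s \<in> {1..m}" and p: "p \<in> {1..m}" and j: "j \<in> {1..r}"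
  shows "K s 1 p (n - 1) * b p j = K p 1 s (n - 1) * b s j"
proof (cases "s = p")
  case False
  then have "bracket (\<delta> (e s 1)) (e p 1) = bracket (\<delta> (e p 1)) (e s 1)"
    using s p n_gt by (intro derivation_zero_bracket[OF der] commute) auto
  then have "coord j n (bracket (\<delta> (e s 1)) (e p 1)) = coord j n (bracket (\<delta> (e p 1)) (e s 1))"
    by (rule arg_cong)
  moreover have "even (n - 1)" using odd_n by simp
  ultimately show ?thesis using s p j n_gt by (simp add: high_coord_bracket_e)
qed simp

text \<open>Two evaluations of \<open>\<delta> (e s n)\<close>: the Leibniz rule gives
  \<open>weight s\<close>, linearity the weights of the first \<open>r\<close> summands.\<close>

lemma derivation_weight:
  assumes der: "derivation \<delta>" and s: "s \<in> {1..m}" and j: "j \<in> {1..r}"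
  shows "b s j * (weight s - weight j) = 0"
proof -
  have "e s n = - bracket (e s 1) (e s (n - 1))"
    using table_n[OF s, of 1] n_gt by simp
  then have "\<delta> (e s n) = - \<delta> (bracket (e s 1) (e s (n - 1)))"
    by (metis delta_linear(4))
  then have "\<delta> (e s n) = - bracket (\<delta> (e s 1)) (e s (n - 1)) - bracket (e s 1) (\<delta> (e s (n - 1)))"
    using der by (simp add: derivation_def)
  moreover have "K s 1 s 0 = 0"
    using derivation_reduced1[OF der s] s n_gt by (simp add: reduced1_def)
  ultimately have "coord j n (\<delta> (e s n)) = weight s * b s j"
    using delta_top[OF s] s j by (simp add: coord_scale coord_high)
  then show ?thesis
    using high_coord_delta_top[OF derivation_reduced1[OF der] s j] by (simp add: algebra_simps)
qed

section \<open>Sufficiency: the Leibniz rule on pairs of basis elements\<close>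

lemma derivation_iff_basis:
  "derivation \<delta> \<longleftrightarrow> (\<forall>s\<in>{1..m}. \<forall>p\<in>{1..m}. \<forall>t\<le>n. \<forall>q\<le>n.
     \<delta> (bracket (e s t) (e p q)) = bracket (\<delta> (e s t)) (e p q) + bracket (e s t) (\<delta> (e p q)))"
  (is "_ \<longleftrightarrow> ?R")
proof
  assume R: ?R
  have left: "\<delta> (bracket x (e p q)) = bracket (\<delta> x) (e p q) + bracket x (\<delta> (e p q))"
    if "p \<in> {1..m}" "q \<le> n" for x p q
  proof (induction x rule: basis_induct)
    case zero then show ?case by (simp add: bracket_zero_left delta_linear)
  next
    case (add x y) then show ?case by (simp add: bracket_add_left delta_linear)
  next
    case (scale a x) then show ?case
      by (simp add: bracket_scale_left delta_linear scale_right_distrib)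
  next
    case (basis i j) then show ?case using R that by blast
  qed
  have "\<delta> (bracket x y) = bracket (\<delta> x) y + bracket x (\<delta> y)" for x y
  proof (induction y rule: basis_induct)
    case zero then show ?case by (simp add: bracket_zero_right delta_linear)
  next
    case (add x y) then show ?case by (simp add: bracket_add_right delta_linear)
  next
    case (scale a x) then show ?case
      by (simp add: bracket_scale_right delta_linear scale_right_distrib)
  next
    case (basis i j) then show ?case by (intro left)
  qed
  then show "derivation \<delta>" using linear by (simp add: derivation_def)
qed (simp add: derivation_def)

context
  assumes red0: "\<And>s. s \<in> {1..m} \<Longrightarrow> reduced0 s" and red1: "\<And>s. s \<in> {1..m} \<Longrightarrow> reduced1 s"
    and odd_zero: "\<And>s i. s \<in> {1..m} \<Longrightarrow> i \<in> {3..n-2} \<Longrightarrow> odd i \<Longrightarrow> K s 1 s i = 0"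
    and cross: "\<And>s p j. \<lbrakk>s \<in> {1..m}; p \<in> {1..m}; j \<in> {1..r}\<rbrakk> \<Longrightarrow>
        K s 1 p (n - 1) * b p j = K p 1 s (n - 1) * b s j"
    and weight_eq: "\<And>s j. \<lbrakk>s \<in> {1..m}; s > r; j \<in> {1..r}\<rbrakk> \<Longrightarrow> b s j * (weight s - weight j) = 0"
begin

lemma K_zero: "s \<in> {1..m} \<Longrightarrow> K s 1 s 0 = 0"
  using red1[of s] n_gt by (simp add: reduced1_def)

text \<open>For \<open>s > r\<close>, condition (i) allows \<open>weight j\<close> to be replaced by
  \<open>weight s\<close> in every term of the expansion of \<open>e s n\<close>.\<close>

lemma delta_top_weight:
  assumes s: "s \<in> {1..m}"
  shows "\<delta> (e s n) = scale (weight s) (e s n)"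
proof (cases "s \<le> r")
  case True
  then show ?thesis using delta_top[OF s K_zero[OF s]] delta_n[of s] s by simp
next
  case False
  have "\<delta> (e s n) = (\<Sum>j=1..r. scale (b s j) (\<delta> (e j n)))"
    by (subst top_expand[OF s]) (simp add: delta_sum delta_linear)
  also have "\<dots> = (\<Sum>j=1..r. scale (weight s) (scale (b s j) (e j n)))"
  proof (rule sum.cong[OF refl])
    fix j assume j: "j \<in> {1..r}"
    then have "\<delta> (e j n) = scale (weight j) (e j n)"
      using delta_top[OF _ K_zero, of j] delta_n[of j] r_le by simp
    moreover have "b s j * weight j = weight s * b s j"
      using weight_eq[OF s _ j] False by auto
    ultimately show "scale (b s j) (\<delta> (e j n)) = scale (weight s) (scale (b s j) (e j n))" by simp
  qed
  also have "\<dots> = scale (weight s) (e s n)"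
    by (subst top_expand[OF s]) (simp only: scale_sum_right)
  finally show ?thesis .
qed

text \<open>Below the top, \<open>\<delta> (e s t)\<close> meets summand \<open>p\<close> only in
  \<open>e p (n - 1)\<close>, and only for \<open>t = 1\<close>; the only \<open>e p q\<close> not
  commuting with it is \<open>e p 1\<close>.\<close>

lemma bracket_delta_cross:
  assumes s: "s \<in> {1..m}" and p: "p \<in> {1..m}" and "s \<noteq> p" "t < n" "q < n"
  shows "bracket (\<delta> (e s t)) (e p q) = scale (if t = 1 \<and> q = 1 then K s 1 p (n - 1) else 0) (e p n)"
proof -
  have K: "K s t p j = 0" if "j < n" "\<not> (t = 1 \<and> j = n - 1)" for j
  proof -
    consider "t = 0" | "t = 1" | "t \<in> {2..n-1}" using \<open>t < n\<close> by fastforce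
    then show ?thesis
      using red0[OF s] red1[OF s] coeff_rec[OF s _ p, of t j] assms that
      by cases (auto simp: reduced0_def reduced1_def)
  qed
  show ?thesis
  proof (cases "q = 0")
    case True
    have "(\<Sum>j=1..n-2. scale (K s t p j) (e p (j + 1))) = 0"
      using n_gt by (intro sum.neutral ballI) (subst K, auto)
    then show ?thesis using True by (simp add: bracket_e0[OF p])
  next
    case False
    have "even (n - 1)" using odd_n by simp
    moreover have "K s t p 0 = 0" using K[of 0] n_gt by simp
    moreover have "K s t p (n - q) = 0" if "\<not> (t = 1 \<and> q = 1)"
      using that False \<open>q < n\<close> by (intro K) auto
    moreover have "q \<in> {1..n-1}" using False \<open>q < n\<close> by auto
    ultimately show ?thesis by (cases "t = 1 \<and> q = 1") (auto simp: bracket_e[OF p])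
  qed
qed

lemma derivation_cross:
  assumes s: "s \<in> {1..m}" and p: "p \<in> {1..m}" and "s \<noteq> p" "t < n" "q < n"
  shows "bracket (\<delta> (e s t)) (e p q) = bracket (\<delta> (e p q)) (e s t)"
proof -
  \<comment> \<open>Condition (v) as a vector equation.\<close>
  have "scale (K s 1 p (n - 1)) (e p n) = scale (K p 1 s (n - 1)) (e s n)"
    unfolding top_expand[OF s] top_expand[OF p] scale_sum_right
    using cross[OF s p] by (intro sum.cong) auto
  then show ?thesis using assms bracket_delta_cross[of s p t q] bracket_delta_cross[of p s q t]
    by (cases "t = 1 \<and> q = 1") auto
qed

text \<open>For \<open>1 \<le> q \<le> n - 2\<close> this is \<open>delta_rec\<close>. At
  \<open>q = n - 1\<close> both terms vanish: the first by \<open>K s 0 s 1 = 0\<close>, the second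
  because \<open>\<delta> (e s (n - 1))\<close> has no coordinates at positions 1 to
  \<open>n - 2\<close>.\<close>

lemma derivation_e0:
  assumes s: "s \<in> {1..m}" and q: "q < n"
  shows "\<delta> (bracket (e s 0) (e s q)) = bracket (\<delta> (e s 0)) (e s q) + bracket (e s 0) (\<delta> (e s q))"
proof -
  consider "q = 0" | "q \<in> {1..n-2}" | "q = n - 1" using q by fastforce
  then show ?thesis
  proof cases
    case 1
    then show ?thesis
      using bracket_swap[of "e s 0" "\<delta> (e s 0)"] by (simp add: bracket_self delta_linear)
  next
    case 2
    then show ?thesis using delta_rec[OF s, of "q + 1"] table_0[OF s, of q] n_gt by auto
  next
    case 3
    have "bracket (e s 0) (e s q) = 0" using 3 s n_gt by (intro table_zero) auto
    moreover have "bracket (\<delta> (e s 0)) (e s q) = 0"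
      using red0[OF s] s n_gt 3 by (subst bracket_e[OF s]) (auto simp: reduced0_def)
    moreover have "K s (n-1) s j = 0" if "j \<in> {1..n-2}" for j
    proof -
      have "j < n - 1" "j < n" using that n_gt by auto
      then show ?thesis using n_gt by (subst coeff_shift[OF s K_zero[OF s]]) auto
    qed
    then have "bracket (\<delta> (e s q)) (e s 0) = 0"
      by (simp add: bracket_e0[OF s] 3)
    ultimately show ?thesis
      using bracket_swap[of "e s 0" "\<delta> (e s q)"] by (simp add: delta_linear)
  qed
qed

text \<open>Both terms are multiples of \<open>e s n\<close>. For \<open>t + q = n\<close> the
  diagonal entries add up to the weight, for \<open>t + q > n\<close> the entries lie before the
  diagonal and vanish, and for \<open>t + q < n\<close> both are the same coefficient of
  \<open>\<delta> (e s 1)\<close>, which cancels or is zero by (iv).\<close>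

lemma derivation_same:
  assumes s: "s \<in> {1..m}" and t: "t \<in> {1..n-1}" and q: "q \<in> {1..n-1}"
  shows "\<delta> (bracket (e s t) (e s q)) = bracket (\<delta> (e s t)) (e s q) + bracket (e s t) (\<delta> (e s q))"
proof -
  note shift = coeff_shift[OF s K_zero[OF s]]
  have formula: "bracket (\<delta> (e s t)) (e s q) = scale ((-1) ^ (n - q) * K s t s (n - q)) (e s n)"
    if "t \<in> {1..n-1}" "q \<in> {1..n-1}" for t q
    using that shift[of t 0] by (simp add: bracket_e[OF s])
  have rhs: "bracket (\<delta> (e s t)) (e s q) + bracket (e s t) (\<delta> (e s q))
      = scale ((-1) ^ (n - q) * K s t s (n - q) - (-1) ^ (n - t) * K s q s (n - t)) (e s n)"
    unfolding bracket_swap[of "e s t" "\<delta> (e s q)"] formula[OF t q] formula[OF q t]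
    by (simp add: scale_left_diff_distrib)
  consider "t + q = n" | "t + q > n" | "t + q < n" by linarith
  then show ?thesis
  proof cases
    case 1
    then have nq: "n - q = t" "n - t = q" "q = n - t" by auto
    have "(-1::complex) ^ q = - ((-1) ^ t)"
      using odd_n 1 by (cases "even t") auto
    moreover have "of_nat (n - 2) = (of_nat (t - 1) + of_nat (q - 1) :: complex)"
      using 1 t q by (simp flip: of_nat_add)
    moreover have "K s t s t = K s 1 s 1 + of_nat (t - 1) * K s 0 s 0"
      "K s q s q = K s 1 s 1 + of_nat (q - 1) * K s 0 s 0"
      using shift[of t t] shift[of q q] t q by auto
    ultimately have "(-1) ^ (n - q) * K s t s (n - q) - (-1) ^ (n - t) * K s q s (n - t) = (-1) ^ t * weight s"
      unfolding nq(1,2) weight_def by (simp add: algebra_simps)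
    moreover have "bracket (e s t) (e s q) = scale ((-1) ^ t) (e s n)"
      using table_n[OF s t] nq(3) by simp
    ultimately show ?thesis unfolding rhs using delta_top_weight[OF s] by (simp add: delta_linear)
  next
    case 2
    have "bracket (e s t) (e s q) = 0" using 2 t q s by (intro table_zero) auto
    moreover have "K s t s (n - q) = 0" "K s q s (n - t) = 0"
      using 2 t q shift[of t "n - q"] shift[of q "n - t"] by auto
    ultimately show ?thesis unfolding rhs by (simp add: delta_linear)
  next
    case 3
    define i where "i = n - q - t + 1"
    have "K s t s (n - q) = K s 1 s i" "K s q s (n - t) = K s 1 s i"
      using 3 t q shift[of t "n - q"] shift[of q "n - t"] by (auto simp: i_def add.commute)
    moreover have "(-1) ^ (n - q) * K s 1 s i = (-1) ^ (n - t) * K s 1 s i"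
    proof (cases "even t \<longleftrightarrow> even q")
      case True
      then have "even (n - q) \<longleftrightarrow> even (n - t)" using t q by auto
      then have "(-1::complex) ^ (n - q) = (-1) ^ (n - t)" by (cases "even (n - t)") auto
      then show ?thesis by simp
    next
      case False
      have "i + (q + t) = n + 1" using 3 by (simp add: i_def)
      then have "odd i" using False odd_n by presburger
      \<comment> \<open>Opposite parity excludes \<open>t = q = 1\<close>, which bounds
        \<open>i\<close> by \<open>n - 2\<close>; being odd and at least 2, \<open>i\<close> is at
        least 3.\<close>
      moreover have "t + q \<noteq> 2" using False t q by presburger
      then have "i \<in> {3..n-2}" using 3 t q \<open>i + (q + t) = n + 1\<close> \<open>odd i\<close> by (cases "i = 2") auto
      ultimately show ?thesis using odd_zero[OF s] by simp
    qed
    moreover have "bracket (e s t) (e s q) = 0" using 3 t q s by (intro table_zero) auto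
    ultimately show ?thesis unfolding rhs by (simp add: delta_linear)
  qed
qed

lemma derivation_of_conditions: "derivation \<delta>"
  unfolding derivation_iff_basis
proof (intro ballI allI impI)
  fix s p t q assume s: "s \<in> {1..m}" and p: "p \<in> {1..m}" and t: "t \<le> n" and q: "q \<le> n"
  have top: "bracket (e i n) x = 0" if "i \<in> {1..m}" for i x
    using bracket_top[OF that, of x] bracket_swap[of "e i n" x] by simp
  show "\<delta> (bracket (e s t) (e p q)) = bracket (\<delta> (e s t)) (e p q) + bracket (e s t) (\<delta> (e p q))"
  proof (cases "t = n \<or> q = n")
    case True
    then show ?thesis using s p
      by (auto simp: delta_top_weight bracket_top top bracket_scale_left bracket_scale_right delta_linear)
  next
    case False
    then have tq: "t < n" "q < n" using t q by auto
    show ?thesis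
    proof (cases "s = p")
      case False
      then show ?thesis
        using commute[OF s p] derivation_cross[OF s p False tq] bracket_swap[of "e s t" "\<delta> (e p q)"] tq
        by (simp add: delta_linear)
    next
      case [simp]: True
      consider "t = 0" | "q = 0" | "t \<in> {1..n-1}" "q \<in> {1..n-1}" using tq by fastforce
      then show ?thesis
      proof cases
        case 1 then show ?thesis using derivation_e0[OF s, of q] tq by simp
      next
        case 2
        then show ?thesis
          using derivation_e0[OF s, of t] tq 2 bracket_swap[of "e p t" "e p 0"]
            bracket_swap[of "\<delta> (e p t)" "e p 0"] bracket_swap[of "e p t" "\<delta> (e p 0)"]
          by (simp add: delta_linear)
      next
        case 3 then show ?thesis using derivation_same[OF s, of t q] by simp
      qed
    qed
  qed
qed

end

theorem derivation_iff_coeff: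
  "derivation \<delta> \<longleftrightarrow> (\<forall>s\<in>{1..m}. \<forall>p\<in>{1..m}.
     (s > r \<longrightarrow> (\<forall>j\<in>{1..r}. b s j * (weight s - weight j) = 0)) \<and>
     reduced0 s \<and> reduced1 s \<and> (\<forall>i\<in>{3..n-2}. odd i \<longrightarrow> K s 1 s i = 0) \<and>
     (\<forall>j\<in>{1..r}. K s 1 p (n - 1) * b p j = K p 1 s (n - 1) * b s j))"
  (is "_ \<longleftrightarrow> ?R")
proof
  assume der: "derivation \<delta>"
  show ?R
    using derivation_weight[OF der] derivation_reduced0[OF der] derivation_reduced1[OF der]
      derivation_odd_coeff[OF der] derivation_cross_coeff[OF der] by blast
next
  assume ?R
  then show "derivation \<delta>" by (intro derivation_of_conditions) blast+
qed

end

section \<open>From coordinates to the coefficients \<open>c\<close>\<close>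

theorem theorem2p1:
  fixes scale :: "complex \<Rightarrow> 'a::ab_group_add \<Rightarrow> 'a"
    and bracket :: "'a \<Rightarrow> 'a \<Rightarrow> 'a"
    and n d m r :: nat
    and N :: "nat \<Rightarrow> 'a set"
    and e :: "nat \<Rightarrow> nat \<Rightarrow> 'a"
    and b :: "nat \<Rightarrow> nat \<Rightarrow> complex"
    and c :: "nat \<Rightarrow> nat \<Rightarrow> nat \<Rightarrow> nat \<Rightarrow> complex"
    and lam :: "nat \<Rightarrow> complex"
    and \<delta> :: "'a \<Rightarrow> 'a"
  assumes lie: "fin_dim_lie_algebra scale bracket"
    and n: "n = 2 * d + 1" "n > 3"
    and quasi: "lie_algebra.quasi_Qn_filiform scale bracket n m r N"
    and adapted: "lie_algebra.adapted_elements scale bracket n m r N e"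
    and b: "\<forall>i\<in>{1..m}. e i n = (\<Sum>j=1..r. scale (b i j) (e j n))"
    and linear: "Vector_Spaces.linear scale scale \<delta>"
    and delta_01: "\<forall>s\<in>{1..m}. \<forall>t\<in>{0,1}. \<delta> (e s t) =
        (\<Sum>i=1..m. \<Sum>j=0..n-1. scale (c s t i j) (e i j)) + (\<Sum>i=1..r. scale (c s t i n) (e i n))"
    and delta_rec: "\<forall>s\<in>{1..m}. \<forall>t\<in>{2..n-1}. \<delta> (e s t) =
        bracket (\<delta> (e s 0)) (e s (t - 1)) + bracket (e s 0) (\<delta> (e s (t - 1)))"
    and delta_n: "\<forall>s\<in>{1..r}. \<delta> (e s n) =
        - bracket (\<delta> (e s 1)) (e s (n - 1)) - bracket (e s 1) (\<delta> (e s (n - 1)))"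
    and lam: "\<forall>s\<in>{1..m}. lam s = of_nat (n - 2) * c s 0 s 0 + 2 * c s 1 s 1"
  shows "lie_algebra.derivation scale bracket \<delta> \<longleftrightarrow>
    (\<forall>s\<in>{1..m}. \<forall>p\<in>{1..m}.
       (s > r \<longrightarrow> (\<forall>j\<in>{1..r}. b s j * (lam s - lam j) = 0)) \<and>
       \<delta> (e s 0) = scale (c s 0 s 0) (e s 0) + (\<Sum>i=2..n-1. scale (c s 0 s i) (e s i))
         + (\<Sum>i=1..r. scale (c s 0 i n) (e i n)) \<and>
       \<delta> (e s 1) = (\<Sum>i=1..n-2. scale (c s 1 s i) (e s i))
         + (\<Sum>i=1..m. scale (c s 1 i (n - 1)) (e i (n - 1)))
         + (\<Sum>i=1..r. scale (c s 1 i n) (e i n)) \<and>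
       (\<forall>i\<in>{3..n-2}. odd i \<longrightarrow> c s 1 s i = 0) \<and>
       (\<forall>j\<in>{1..r}. - c s 1 p (n - 1) * b p j + c p 1 s (n - 1) * b s j = 0))"
proof -
  interpret fin_dim_lie_algebra scale bracket by (rule lie)
  have fam: "basis_family {0..n} (e i) (N i)" "Qn_brackets n (e i)" if "i \<in> {1..m}" for i
    using adapted that by (auto simp: adapted_elements_def)
  \<comment> \<open>The term of the central series whose dimension is \<open>r\<close> is spanned by
    \<open>m\<close> elements.\<close>
  have r_le: "r \<le> m"
  proof -
    have "r = dim (span {e i n | i. i \<in> {1..m}})"
      using quasi adapted by (simp add: quasi_Qn_filiform_def adapted_elements_def)
    also have "\<dots> \<le> card {e i n | i. i \<in> {1..m}}"
      unfolding dim_span by (rule dim_le_card'[of "{e i n | i. i \<in> {1..m}}"]) simp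
    also have "{e i n | i. i \<in> {1..m}} = (\<lambda>i. e i n) ` {1..m}" by auto
    also have "card \<dots> \<le> m" using card_image_le[of "{1..m}" "\<lambda>i. e i n"] by simp
    finally show ?thesis .
  qed
  have mem: "e i j \<in> N i" if "i \<in> {1..m}" "j \<le> n" for i j
    using fam(1)[OF that(1)] that(2) span_base[of "e i j" "e i ` {0..n}"]
    by (auto simp: basis_family_def)
  interpret Qn_sum_map scale bracket n m r e b \<delta>
  proof unfold_locales
    show "odd n" "n > 3" "r \<le> m" using n r_le by auto
    show "Qn_brackets n (e i)" if "i \<in> {1..m}" for i using fam that by blast
    show "bracket (e i j) (e k l) = 0"
      if "i \<in> {1..m}" "k \<in> {1..m}" "i \<noteq> k" "j \<le> n" "l \<le> n" for i k j l
      using quasi that mem unfolding quasi_Qn_filiform_def by blast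
    show "e i n \<noteq> 0" if "i \<in> {1..m}" for i
    proof -
      have "independent (e i ` {0..n})" using fam(1)[OF that] by (simp add: basis_family_def)
      moreover have "e i n \<in> e i ` {0..n}" by simp
      ultimately show ?thesis using dependent_zero by metis
    qed
    show "basis_family ({1..m} \<times> {0..n-1} \<union> {1..r} \<times> {n}) (\<lambda>(i, j). e i j) UNIV"
      using adapted by (simp add: adapted_elements_def)
  qed (use b linear delta_rec delta_n in \<open>(blast | simp add: Vector_Spaces.linear_iff)+\<close>)
  \<comment> \<open>The restriction to \<open>idx\<close> matters: for \<open>i > r\<close> the
    number \<open>c s t i n\<close> occurs in no expansion.\<close>
  have coeff: "K s t i j = c s t i j" if "s \<in> {1..m}" "t \<in> {0, 1}" "(i, j) \<in> idx" for s t i j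
    by (subst delta_01[rule_format, OF that(1,2)]) (rule coord_expansion[OF that(3)])
  have low: "K s t i j = c s t i j" if "s \<in> {1..m}" "t \<in> {0, 1}" "i \<in> {1..m}" "j < n" for s t i j
    using that by (intro coeff) auto
  have weight: "weight s = lam s" if "s \<in> {1..m}" for s
    using lam that n_gt low[of s 0 s 0] low[of s 1 s 1] by (simp add: weight_def)
  show ?thesis
    unfolding derivation_iff_coeff
  proof (intro ball_cong refl conj_cong)
    fix s p assume s: "s \<in> {1..m}" and p: "p \<in> {1..m}"
    show "(s > r \<longrightarrow> (\<forall>j\<in>{1..r}. b s j * (weight s - weight j) = 0)) \<longleftrightarrow>
        (s > r \<longrightarrow> (\<forall>j\<in>{1..r}. b s j * (lam s - lam j) = 0))"
      using s weight r_le by simp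
    show "reduced0 s \<longleftrightarrow> \<delta> (e s 0) = scale (c s 0 s 0) (e s 0) + (\<Sum>i=2..n-1. scale (c s 0 s i) (e s i))
         + (\<Sum>i=1..r. scale (c s 0 i n) (e i n))"
      unfolding reduced0_def using s
      by (subst expansion0_iff[OF s, where f = "c s 0"]) (auto simp: coeff low)
    show "reduced1 s \<longleftrightarrow> \<delta> (e s 1) = (\<Sum>i=1..n-2. scale (c s 1 s i) (e s i))
         + (\<Sum>i=1..m. scale (c s 1 i (n - 1)) (e i (n - 1)))
         + (\<Sum>i=1..r. scale (c s 1 i n) (e i n))"
      unfolding reduced1_def using s
      by (subst expansion1_iff[OF s, where f = "c s 1"]) (auto simp: coeff low)
    show "(odd i \<longrightarrow> K s 1 s i = 0) \<longleftrightarrow> (odd i \<longrightarrow> c s 1 s i = 0)" if "i \<in> {3..n-2}" for i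
      using low[of s 1 s i] s that by auto
    show "K s 1 p (n - 1) * b p j = K p 1 s (n - 1) * b s j \<longleftrightarrow>
        - c s 1 p (n - 1) * b p j + c p 1 s (n - 1) * b s j = 0" if "j \<in> {1..r}" for j
      using low[of s 1 p "n - 1"] low[of p 1 s "n - 1"] s p n_gt by (auto simp: algebra_simps)
  qed
qed

end
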